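(* For given non-negative integers $n$ and $k$ with $n>k$, $$\Omega(n,k)=\lambda_k\, D_{n-1,\,n-k-1},\qquad\text{where}\qquad \lambda_k=\left(k\sum_{i=0}^{k}\frac{(-1)^{i+k+1}}{i!}\right)^{-1}.$$ Equivalently, $$D_{n,k}=(n-k)\sum_{i=0}^{n-k}\frac{(-1)^{i+n-k+1}}{i!}\,\Omega(n+1,n-k).$$ Here $\lambda_k$ depends only on $k$.
   Context: The integers $\Omega(a,b)$, for $a\in\mathbb{Z}_{>0}$ and $b\in\mathbb{Z}_{\ge 0}$, are defined recursively by: $\Omega(a,0)=1$; $\Omega(a,b)=0$ if $b\ge a$ and $b\ge 1$; $\Omega(a,1)=\Omega(a-1,1)+1$ for $a\ge 2$; and $\Omega(a,b)=\Omega(a-1,b)-(b-1)\,\Omega(a-1,b-1)$ for $2\le b\le a-1$. The rencontres number $D_{n,k}$ is the number of permutations of $n$ items having exactly $k$ fixed points. It is given by $D_{n,k}=\binom{n}{k}D_{n-k}$, where $D_m=m!\sum_{i=0}^{m}\frac{(-1)^i}{i!}$.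
   Formalization: The first identity is stated only for k ≥ 2, because for k = 0 and k = 1 the quantity inverted in λ_k is 0, so λ_k is undefined; the second identity is stated for all n > k. *)

theory Defs
  imports Complex_Main "HOL-Combinatorics.Permutations"
begin

text \<open>The recursion is meant for \<open>a > 0\<close>; on that domain every recursive call stays
  inside it. The values \<open>Omega 0 b\<close> are junk.\<close>

fun Omega :: "nat \<Rightarrow> nat \<Rightarrow> int" where
  "Omega a b =
     (if b = 0 then 1
      else if b \<ge> a then 0
      else if b = 1 then Omega (a - 1) 1 + 1
      else Omega (a - 1) b - (int b - 1) * Omega (a - 1) (b - 1))"

declare Omega.simps [simp del]

definition rencontres :: "nat \<Rightarrow> nat \<Rightarrow> nat" where
  "rencontres n k = card {p. p permutes {..<n} \<and> card {i \<in> {..<n}. p i = i} = k}"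

definition lambda_den :: "nat \<Rightarrow> real" where
  "lambda_den k = real k * (\<Sum>i=0..k. (-1) ^ (i + k + 1) / fact i)"

text \<open>The quantity to be inverted vanishes for \<open>k = 0\<close> and \<open>k = 1\<close>, so \<open>lam k\<close> is
  meaningful exactly for \<open>k \<ge> 2\<close>; see \<open>lambda_den_nonzero_iff\<close> below.\<close>

definition lam :: "nat \<Rightarrow> real" where
  "lam k = inverse (lambda_den k)"

lemma alternating_sum_lower_bound:
  assumes "2 \<le> k"
  shows "1 / fact k \<le> (\<Sum>i=0..k. (-1) ^ i / fact i :: real)"
  using assms
proof (induction k rule: dec_induct)
  case base
  show ?case by (simp add: numeral_2_eq_2)
next
  case (step m)
  have "- 1 / fact (Suc m) \<le> ((-1) ^ Suc m / fact (Suc m) :: real)"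
    by (cases "even m") (simp_all add: divide_right_mono)
  moreover have "2 / fact (Suc m) \<le> (1 / fact m :: real)"
  proof -
    have "2 * fact m \<le> (real (Suc m) * fact m :: real)"
      using step.hyps by (intro mult_right_mono) simp_all
    then show ?thesis
      by (simp add: divide_simps del: of_nat_Suc)
  qed
  ultimately show ?case
    using step.IH by simp
qed

lemma lambda_den_nonzero_iff: "lambda_den k \<noteq> 0 \<longleftrightarrow> 2 \<le> k"
proof
  assume "lambda_den k \<noteq> 0"
  then show "2 \<le> k"
    by (cases "k = 0 \<or> k = 1") (auto simp: lambda_den_def)
next
  assume k: "2 \<le> k"
  have "(\<Sum>i=0..k. (-1) ^ (i + k + 1) / fact i :: real)
      = (-1) ^ (k + 1) * (\<Sum>i=0..k. (-1) ^ i / fact i)"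
    by (simp add: sum_distrib_left power_add mult.commute)
  moreover have "(\<Sum>i=0..k. (-1) ^ i / fact i :: real) > 0"
    using alternating_sum_lower_bound[OF k] by (rule less_le_trans[rotated]) simp
  ultimately show "lambda_den k \<noteq> 0"
    using k by (simp add: lambda_den_def)
qed

end

theory Submission imports Defs begin

text \<open>
  Both identities compare closed forms. Up to sign and factorial, the recursion for
  \<open>Omega\<close> is Pascal's rule: for \<open>b \<ge> 1\<close> the substitution
  \<open>Omega a b = (-1) ^ (b - 1) * (b - 1)! * c a b\<close> turns the factor \<open>-(b - 1)\<close> of the
  recursion into \<open>1\<close>, so that \<open>c a b = c (a - 1) b + c (a - 1) (b - 1)\<close>, and the
  boundary values identify \<open>c a b\<close> as the binomial coefficient of \<open>a - 1\<close> over \<open>b\<close>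
  (\<open>Omega_closed_form\<close>).

  On the other side, a permutation of \<open>n\<close> points with \<open>k\<close> fixed points is a derangement of
  the \<open>n - k\<close> points that it moves. Choosing these points contributes a binomial
  coefficient, and Moebius inversion over the subsets of a finite set counts the
  derangements (\<open>card_derangements\<close>). The same alternating sum of inverse factorials
  occurs in this count and, up to sign, in \<open>lambda_den\<close>, so it cancels in the first
  identity; in both identities the remaining factorials and binomial coefficients agree
  because \<open>b! = b * (b - 1)!\<close>.
\<close>

text \<open>The shifted arguments avoid truncated subtraction. The formula also covers the zeros
  at \<open>b \<ge> a\<close>, where the binomial coefficient vanishes. The unit added in the recursion for
  \<open>b = 1\<close> is the binomial coefficient over \<open>0\<close>, so that case is Pascal's rule as well.\<close>

lemma Omega_closed_form:
  "Omega (Suc a) (Suc b) = (-1) ^ b * fact b * int (a choose Suc b)"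
proof (induction a arbitrary: b)
  case 0
  show ?case by (simp add: Omega.simps)
next
  case (Suc a)
  show ?case
  proof (cases b)
    case 0
    then show ?thesis
      using Suc.IH[of 0] by (subst Omega.simps) simp
  next
    case (Suc c)
    show ?thesis
    proof (cases "Suc b \<ge> Suc (Suc a)")
      case True
      then show ?thesis
        by (subst Omega.simps) (simp add: binomial_eq_0)
    next
      case False
      then have "Omega (Suc (Suc a)) (Suc b)
          = Omega (Suc a) (Suc b) - int b * Omega (Suc a) (Suc c)"
        using Suc by (subst Omega.simps) simp
      also have "\<dots> = (-1) ^ b * fact b * int (a choose Suc b)
          - int b * ((-1) ^ c * fact c * int (a choose Suc c))"
        by (simp only: Suc.IH)
      also have "\<dots> = (-1) ^ b * fact b * int (Suc a choose Suc b)"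
        using Suc by (simp add: algebra_simps)
      finally show ?thesis .
    qed
  qed
qed

corollary Omega_eq_binomial:
  assumes "0 < a" "0 < b"
  shows "real_of_int (Omega a b) = (-1) ^ (b - 1) * fact (b - 1) * real (a - 1 choose b)"
  using Omega_closed_form[of "a - 1" "b - 1"] assms by simp

definition derangements :: "'a set \<Rightarrow> ('a \<Rightarrow> 'a) set" where
  "derangements S = {p. p permutes S \<and> (\<forall>i\<in>S. p i \<noteq> i)}"

text \<open>Outside the set of points that a permutation moves it is the identity, so every
  permutation of \<open>S\<close> is a derangement of exactly one subset of \<open>S\<close>. This is the
  decomposition behind both counts below.\<close>

lemma derangements_eq_moved_points:
  assumes "T \<subseteq> S"
  shows "derangements T = {p. p permutes S \<and> {i \<in> S. p i \<noteq> i} = T}"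
proof (intro set_eqI iffI)
  fix p assume "p \<in> derangements T"
  then have p: "p permutes T" "\<forall>i\<in>T. p i \<noteq> i"
    by (auto simp: derangements_def)
  then have "p i \<noteq> i \<longleftrightarrow> i \<in> T" for i
    using permutes_not_in[OF p(1)] by auto
  then have "{i \<in> S. p i \<noteq> i} = S \<inter> T"
    by (simp add: Int_def)
  then show "p \<in> {p. p permutes S \<and> {i \<in> S. p i \<noteq> i} = T}"
    using assms permutes_subset[OF p(1) assms] by (simp add: Int_absorb1)
next
  fix p assume p: "p \<in> {p. p permutes S \<and> {i \<in> S. p i \<noteq> i} = T}"
  have "p permutes T"
    by (rule permutes_superset[of p S]) (use p in auto)
  then show "p \<in> derangements T"
    using p by (auto simp: derangements_def)
qed

lemma sum_card_derangements_subsets: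
  assumes "finite S"
  shows "(\<Sum>T\<in>Pow S. card (derangements T)) = fact (card S)"
proof -
  let ?P = "{p. p permutes S}"
  have "(\<Sum>T\<in>Pow S. card (derangements T))
      = (\<Sum>T\<in>Pow S. \<Sum>p\<in>{p \<in> ?P. {i \<in> S. p i \<noteq> i} = T}. 1)"
    by (intro sum.cong) (auto simp: derangements_eq_moved_points)
  also have "\<dots> = (\<Sum>p\<in>?P. 1)"
    using assms by (intro sum.group) (auto intro: finite_permutations)
  finally show ?thesis
    using card_permutations[OF refl assms] by simp
qed

lemma sum_Pow_card:
  fixes f :: "nat \<Rightarrow> 'b::semiring_1"
  assumes "finite S"
  shows "(\<Sum>T\<in>Pow S. f (card T)) = (\<Sum>j\<le>card S. of_nat (card S choose j) * f j)"
proof -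
  have "(\<Sum>T\<in>Pow S. f (card T)) = (\<Sum>j\<le>card S. \<Sum>T\<in>{T \<in> Pow S. card T = j}. f (card T))"
    using assms by (intro sum.group[symmetric]) (auto intro: card_mono)
  also have "\<dots> = (\<Sum>j\<le>card S. of_nat (card S choose j) * f j)"
    using n_subsets[OF assms] by (intro sum.cong) auto
  finally show ?thesis .
qed

text \<open>Moebius inversion of \<open>sum_card_derangements_subsets\<close> writes the count as an
  alternating sum of \<open>(card T)!\<close> over all subsets \<open>T\<close>. Grouping the subsets by cardinality
  and indexing by the size of the complement gives the stated form.\<close>

lemma card_derangements:
  assumes "finite S"
  shows "real (card (derangements S)) = fact (card S) * (\<Sum>i\<le>card S. (-1) ^ i / fact i)"
proof -
  let ?m = "card S"
  have "real (card (derangements S)) = (\<Sum>T\<in>Pow S. (-1) ^ (?m - card T) * fact (card T))"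
  proof (rule inclusion_exclusion_mobius[OF _ assms])
    fix T :: "'a set" assume "finite T"
    then show "fact (card T) = (\<Sum>U\<in>Pow T. real (card (derangements U)))"
      using sum_card_derangements_subsets[of T, THEN arg_cong[where f = real]] by simp
  qed
  also have "\<dots> = (\<Sum>j\<le>?m. real (?m choose j) * ((-1) ^ (?m - j) * fact j))"
    by (rule sum_Pow_card[OF assms])
  also have "\<dots> = (\<Sum>j\<le>?m. fact ?m * ((-1) ^ (?m - j) / fact (?m - j)))"
    by (intro sum.cong) (auto simp: binomial_fact)
  also have "\<dots> = (\<Sum>i\<le>?m. fact ?m * ((-1) ^ i / fact i))"
    by (rule sum.reindex_bij_witness[where i = "\<lambda>i. ?m - i" and j = "\<lambda>j. ?m - j"]) simp_all
  finally show ?thesis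
    by (simp add: sum_distrib_left)
qed

lemma rencontres_eq:
  assumes "k \<le> n"
  shows "real (rencontres n k)
    = real (n choose (n - k)) * (fact (n - k) * (\<Sum>i\<le>n - k. (-1) ^ i / fact i))"
proof -
  let ?S = "{..<n}"
  let ?moved = "\<lambda>p. {i \<in> ?S. p i \<noteq> i}"
  let ?P = "{p. p permutes ?S \<and> card (?moved p) = n - k}"
  let ?C = "{T. T \<subseteq> ?S \<and> card T = n - k}"
  have card_fixed: "card {i \<in> ?S. p i = i} = k \<longleftrightarrow> card (?moved p) = n - k" for p :: "nat \<Rightarrow> nat"
  proof -
    have "card ?S = card ({i \<in> ?S. p i = i} \<union> ?moved p)"
      by (intro arg_cong[where f = card]) auto
    also have "\<dots> = card {i \<in> ?S. p i = i} + card (?moved p)"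
      by (intro card_Un_disjoint) auto
    finally show ?thesis using assms by auto
  qed
  have "real (rencontres n k) = (\<Sum>p\<in>?P. 1)"
    by (simp only: rencontres_def card_fixed) simp
  also have "\<dots> = (\<Sum>T\<in>?C. \<Sum>p\<in>{p \<in> ?P. ?moved p = T}. 1)"
    by (intro sum.group[symmetric])
      (auto intro: finite_subset[OF _ finite_permutations[of ?S]])
  also have "\<dots> = (\<Sum>T\<in>?C. real (card (derangements T)))"
  proof (intro sum.cong refl)
    fix T assume T: "T \<in> ?C"
    then have "{p \<in> ?P. ?moved p = T} = derangements T"
      by (auto simp: derangements_eq_moved_points[of T ?S])
    then show "(\<Sum>p\<in>{p \<in> ?P. ?moved p = T}. 1) = real (card (derangements T))"
      by simp
  qed
  also have "\<dots> = (\<Sum>T\<in>?C. fact (n - k) * (\<Sum>i\<le>n - k. (-1) ^ i / fact i))"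
    by (intro sum.cong) (auto simp: card_derangements finite_subset[of _ ?S])
  finally show ?thesis
    using n_subsets[of ?S "n - k"] by simp
qed

lemma lambda_den_eq:
  "lambda_den k = (-1) ^ (k + 1) * (real k * (\<Sum>i\<le>k. (-1) ^ i / fact i))"
  by (simp add: lambda_den_def atMost_atLeast0 power_add sum_distrib_left mult_ac)

text \<open>Both identities of the proposition are instances: the first replaces \<open>n\<close> by \<open>n - 1\<close> and
  divides by \<open>lambda_den k\<close>, the second replaces \<open>k\<close> by \<open>n - k\<close>. Without the division,
  \<open>k = 1\<close> is included: both sides then vanish, since a single point has no derangement.\<close>

lemma rencontres_eq_lambda_den_times_Omega:
  assumes "0 < k" "k \<le> n"
  shows "real (rencontres n (n - k)) = lambda_den k * real_of_int (Omega (n + 1) k)"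
proof -
  let ?s = "\<Sum>i\<le>k. (-1) ^ i / fact i :: real"
  have fact: "fact k = real k * fact (k - 1)"
    using assms by (intro fact_reduce)
  have sign: "(-1) ^ (k + 1) * (-1) ^ (k - 1) = (1::real)"
    using assms by (cases k) simp_all
  have "lambda_den k * real_of_int (Omega (n + 1) k)
      = ((-1) ^ (k + 1) * (-1) ^ (k - 1)) * (real (n choose k) * (real k * fact (k - 1) * ?s))"
    using assms by (simp add: lambda_den_eq Omega_eq_binomial mult_ac)
  also have "\<dots> = real (n choose k) * (fact k * ?s)"
    by (simp only: sign fact mult_1)
  also have "\<dots> = real (rencontres n (n - k))"
    using assms by (simp add: rencontres_eq)
  finally show ?thesis by simp
qed

theorem proposition4p6:
  fixes n k :: nat
  assumes "k < n"
  shows "(2 \<le> k \<longrightarrow>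
            real_of_int (Omega n k) = lam k * real (rencontres (n - 1) (n - k - 1))) \<and>
         real (rencontres n k) =
            real (n - k) * (\<Sum>i=0..n-k. (-1) ^ (i + n - k + 1) / fact i)
              * real_of_int (Omega (n + 1) (n - k))"
proof
  show "2 \<le> k \<longrightarrow>
      real_of_int (Omega n k) = lam k * real (rencontres (n - 1) (n - k - 1))"
  proof
    assume k: "2 \<le> k"
    have "real (rencontres (n - 1) (n - k - 1)) = lambda_den k * real_of_int (Omega n k)"
      using rencontres_eq_lambda_den_times_Omega[of k "n - 1"] assms k
      by (simp add: diff_commute)
    moreover have "lambda_den k \<noteq> 0"
      using k lambda_den_nonzero_iff by blast
    ultimately show "real_of_int (Omega n k) = lam k * real (rencontres (n - 1) (n - k - 1))"
      by (simp add: lam_def)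
  qed
next
  have "real (n - k) * (\<Sum>i=0..n-k. (-1) ^ (i + n - k + 1) / fact i) = lambda_den (n - k)"
    using assms by (simp add: lambda_den_def)
  then show "real (rencontres n k) =
      real (n - k) * (\<Sum>i=0..n-k. (-1) ^ (i + n - k + 1) / fact i)
        * real_of_int (Omega (n + 1) (n - k))"
    using rencontres_eq_lambda_den_times_Omega[of "n - k" n] assms by simp
qed

end
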